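(* For every tree $T$, the ray space $\mathcal{R}(T)$ is base-complete, and hence Baire.
   Context: A tree is a partially ordered set $T$ with a unique minimal element such that the set of predecessors of any element is well-ordered (distinct limit nodes may have the same set of strict predecessors). A path in $T$ is a nonempty down-closed chain; a ray is a path without maximal element. The ray space $\mathcal{R}(T)$ is the set of all rays of $T$ with the subspace topology inherited from $2^T$ (product topology), rays being identified with their characteristic functions. A collection of sets is centered if every nonempty finite subfamily has nonempty intersection; a collection $\mathcal{A}$ is complete if every nonempty centered subfamily of $\mathcal{A}$ has nonempty intersection. A space is base-complete if it admits a base (of open sets) that is complete. A space is Baire if the intersection of countably many dense open sets is dense. *)

theory Defs
  imports "HOL-Analysis.Analysis"
begin

section \<open>Order trees and their rays\<close>

text \<open>An order is given by its carrier \<open>T\<close> and its non-strict order relation \<open>r\<close>, where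
  \<open>(x, y) \<in> r\<close> means \<open>x \<le> y\<close>. No Hausdorff condition at limits is imposed: distinct nodes may have
  the same set of strict predecessors.\<close>

definition order_tree :: "'a set \<Rightarrow> 'a rel \<Rightarrow> bool" where
  "order_tree T r \<longleftrightarrow>
     partial_order_on T r \<and>
     (\<exists>!m. m \<in> T \<and> underS r m = {}) \<and>
     (\<forall>x\<in>T. well_order_on (underS r x) (Restr r (underS r x)))"

definition tree_path :: "'a set \<Rightarrow> 'a rel \<Rightarrow> 'a set \<Rightarrow> bool" where
  "tree_path T r P \<longleftrightarrow>
     P \<noteq> {} \<and> P \<subseteq> T \<and> total_on P r \<and> (\<forall>x\<in>P. under r x \<subseteq> P)"

definition tree_ray :: "'a set \<Rightarrow> 'a rel \<Rightarrow> 'a set \<Rightarrow> bool" where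
  "tree_ray T r P \<longleftrightarrow> tree_path T r P \<and> \<not> (\<exists>x\<in>P. aboveS r x \<inter> P = {})"

text \<open>The space \<open>2\<^sup>T\<close> is the product of \<open>T\<close> copies of the two-point discrete space. Its points are the
  functions \<open>'a \<Rightarrow> bool\<close> that are extensional on \<open>T\<close>, whence the restriction in the characteristic
  function of a subset.\<close>

definition char_fun :: "'a set \<Rightarrow> 'a set \<Rightarrow> 'a \<Rightarrow> bool" where
  "char_fun T P = (\<lambda>t\<in>T. t \<in> P)"

definition ray_space :: "'a set \<Rightarrow> 'a rel \<Rightarrow> ('a \<Rightarrow> bool) topology" where
  "ray_space T r =
     subtopology (product_topology (\<lambda>_. discrete_topology UNIV) T)
       (char_fun T ` {R. tree_ray T r R})"

section \<open>Base-complete spaces and Baire spaces\<close>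

definition centered :: "'a set set \<Rightarrow> bool" where
  "centered \<A> \<longleftrightarrow> (\<forall>\<F>. \<F> \<subseteq> \<A> \<and> finite \<F> \<and> \<F> \<noteq> {} \<longrightarrow> \<Inter>\<F> \<noteq> {})"

definition complete_family :: "'a set set \<Rightarrow> bool" where
  "complete_family \<A> \<longleftrightarrow> (\<forall>\<C>. \<C> \<subseteq> \<A> \<and> \<C> \<noteq> {} \<and> centered \<C> \<longrightarrow> \<Inter>\<C> \<noteq> {})"

definition open_base :: "'a topology \<Rightarrow> 'a set set \<Rightarrow> bool" where
  "open_base X \<B> \<longleftrightarrow> openin X = arbitrary union_of (\<lambda>U. U \<in> \<B>)"

definition base_complete :: "'a topology \<Rightarrow> bool" where
  "base_complete X \<longleftrightarrow> (\<exists>\<B>. open_base X \<B> \<and> complete_family \<B>)"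

text \<open>The intersection with the whole space only matters for the empty family, as \<open>\<Inter>{} = UNIV\<close>.\<close>

definition Baire_space :: "'a topology \<Rightarrow> bool" where
  "Baire_space X \<longleftrightarrow>
     (\<forall>\<G>. countable \<G> \<and> (\<forall>U\<in>\<G>. openin X U \<and> X closure_of U = topspace X)
        \<longrightarrow> X closure_of (topspace X \<inter> \<Inter>\<G>) = topspace X)"

end

theory Submission
  imports Defs
begin

text \<open>For a node \<open>t\<close> and a finite set \<open>F\<close> of limit nodes, consider the set of all rays that contain \<open>t\<close>
  and avoid \<open>F\<close>. These sets form a base: a ray \<open>R\<close> that avoids a node \<open>b\<close> either has an element not
  below \<open>b\<close>, or it is the set of strict predecessors of some node below \<open>b\<close>, which is then limit.
  Given a centered family of such sets, the nodes \<open>t\<close> form a chain. If this chain has no maximum, its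
  down-closure is the required ray. If it has a maximum \<open>t\<close>, then either no forbidden node lies above
  \<open>t\<close> and any ray through \<open>t\<close> will do, or the strict predecessors of a minimal forbidden
  node above \<open>t\<close> are the required ray. Base-completeness implies the Baire property by shrinking base
  elements.\<close>

section \<open>Base-complete spaces are Baire\<close>

lemma base_complete_imp_Baire_space:
  assumes "base_complete X"
  shows "Baire_space X"
  unfolding Baire_space_def
proof (intro allI impI)
  fix \<G> assume asm: "countable \<G> \<and> (\<forall>U\<in>\<G>. openin X U \<and> X closure_of U = topspace X)"
  obtain \<B> where base: "open_base X \<B>" and compl: "complete_family \<B>"
    using assms unfolding base_complete_def by blast
  have opB: "openin X B" if "B \<in> \<B>" for B
    using base that unfolding open_base_def by (simp add: union_of_inc arbitrary_def)
  have refine: "\<exists>B\<in>\<B>. B \<noteq> {} \<and> B \<subseteq> V" if "openin X V" "V \<noteq> {}" for V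
  proof -
    have "(arbitrary union_of (\<lambda>U. U \<in> \<B>)) V"
      using base that(1) unfolding open_base_def by metis
    then obtain \<U> where "\<U> \<subseteq> \<B>" "\<Union>\<U> = V"
      by (auto simp: union_of_def arbitrary_def)
    then show ?thesis using that(2) by blast
  qed
  show "X closure_of (topspace X \<inter> \<Inter>\<G>) = topspace X"
  proof (cases "\<G> = {}")
    case False
    \<comment> \<open>The enumeration may repeat members, so finite families \<open>\<G>\<close> are
      covered as well.\<close>
    define G where "G = from_nat_into \<G>"
    have G_range: "range G = \<G>"
      using False asm by (simp add: G_def)
    then have G_in: "G n \<in> \<G>" for n by blast
    have opG: "openin X (G n)" for n using asm G_in by blast
    have meets: "G n \<inter> V \<noteq> {}" if "openin X V" "V \<noteq> {}" for n V
      using asm G_in[of n] that by (metis dense_intersects_open)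
    have "(topspace X \<inter> \<Inter>\<G>) \<inter> V \<noteq> {}" if V: "openin X V" "V \<noteq> {}" for V
    proof -
      \<comment> \<open>Each base element is chosen inside the previous one and inside the next
        dense open set. A point common to all of them then lies in \<open>V\<close> and in every
        member of \<open>\<G>\<close>.\<close>
      have "\<exists>B. \<forall>n. (B n \<in> \<B> \<and> B n \<noteq> {} \<and> B n \<subseteq> V \<inter> G n) \<and> B (Suc n) \<subseteq> B n"
      proof (rule dependent_nat_choice)
        have "openin X (V \<inter> G 0)" "V \<inter> G 0 \<noteq> {}"
          using V opG meets[of V 0] by blast+
        then show "\<exists>B. B \<in> \<B> \<and> B \<noteq> {} \<and> B \<subseteq> V \<inter> G 0" using refine by blast
      next
        fix B n assume B: "B \<in> \<B> \<and> B \<noteq> {} \<and> B \<subseteq> V \<inter> G n"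
        have "openin X (B \<inter> G (Suc n))" "B \<inter> G (Suc n) \<noteq> {}"
          using B opB opG meets[of B "Suc n"] by blast+
        then obtain B' where "B' \<in> \<B>" "B' \<noteq> {}" "B' \<subseteq> B \<inter> G (Suc n)" using refine by metis
        then show "\<exists>B'. (B' \<in> \<B> \<and> B' \<noteq> {} \<and> B' \<subseteq> V \<inter> G (Suc n)) \<and> B' \<subseteq> B"
          using B by blast
      qed
      then obtain B where B: "\<And>n. B n \<in> \<B>" "\<And>n. B n \<noteq> {}" "\<And>n. B n \<subseteq> V \<inter> G n"
        and dec: "\<And>n. B (Suc n) \<subseteq> B n" by blast
      have anti: "B n \<subseteq> B m" if "m \<le> n" for m n
        using lift_Suc_antimono_le[of B, OF dec that] .
      have "centered (range B)"
        unfolding centered_def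
      proof (intro allI impI)
        fix \<F> assume "\<F> \<subseteq> range B \<and> finite \<F> \<and> \<F> \<noteq> {}"
        then obtain N where N: "finite N" "\<F> = B ` N"
          by (metis finite_subset_image)
        \<comment> \<open>The sequence decreases, so the term with the largest index in
          \<open>N\<close> is contained in all the others.\<close>
        have "B (Max N) \<subseteq> \<Inter>\<F>"
          using N anti[OF Max_ge] by blast
        then show "\<Inter>\<F> \<noteq> {}" using B(2) by blast
      qed
      moreover have "range B \<subseteq> \<B> \<and> range B \<noteq> {}" using B(1) by blast
      ultimately have "\<Inter>(range B) \<noteq> {}"
        using compl unfolding complete_family_def by meson
      then obtain x where "\<And>n. x \<in> B n" by blast
      then have "x \<in> V \<inter> G n" for n using B(3)[of n] by blast
      then have "x \<in> V" "x \<in> \<Inter>\<G>"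
        unfolding G_range[symmetric] by blast+
      then show ?thesis using openin_subset[OF V(1)] by blast
    qed
    then show ?thesis by (metis dense_intersects_open)
  qed simp
qed

section \<open>Open sets of the ray space, limit nodes and basic cylinders\<close>

lemma char_fun_inj:
  assumes "char_fun T P = char_fun T Q" "P \<subseteq> T" "Q \<subseteq> T"
  shows "P = Q"
proof -
  have "t \<in> P \<longleftrightarrow> t \<in> Q" if "t \<in> T" for t
    using fun_cong[OF assms(1), of t] that by (simp add: char_fun_def)
  then show ?thesis using assms(2,3) by blast
qed

lemma tree_ray_subset: "tree_ray T r R \<Longrightarrow> R \<subseteq> T"
  unfolding tree_ray_def tree_path_def by blast

lemma topspace_ray_space: "topspace (ray_space T r) = char_fun T ` {R. tree_ray T r R}"
  unfolding ray_space_def by (auto simp: char_fun_def)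

text \<open>Only the finitely many coordinates in \<open>A\<close> and \<open>B\<close> are
  constrained, so an open box of the product cuts out the set. If \<open>A\<close> is not inside
  \<open>T\<close>, no ray contains it and the set is empty.\<close>

lemma openin_ray_space_cylinder:
  assumes "finite A" "finite B"
  shows "openin (ray_space T r) (char_fun T ` {R. tree_ray T r R \<and> A \<subseteq> R \<and> R \<inter> B = {}})"
proof -
  let ?S = "{R. tree_ray T r R}"
  let ?U = "\<lambda>i. {b. (i \<in> A \<longrightarrow> b) \<and> (i \<in> B \<longrightarrow> \<not> b)}"
  show ?thesis
  proof (cases "A \<subseteq> T")
    case True
    have "{i \<in> T. ?U i \<noteq> UNIV} \<subseteq> A \<union> B" by auto
    then have "finite {i \<in> T. ?U i \<noteq> UNIV}"
      using assms by (meson finite_Un finite_subset)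
    then have "openin (product_topology (\<lambda>_. discrete_topology UNIV) T) (PiE T ?U)"
      by (simp add: openin_PiE_gen)
    moreover have "char_fun T ` {R. tree_ray T r R \<and> A \<subseteq> R \<and> R \<inter> B = {}} = PiE T ?U \<inter> char_fun T ` ?S"
    proof -
      have "char_fun T R \<in> PiE T ?U \<longleftrightarrow> A \<subseteq> R \<and> R \<inter> B = {}" if "tree_ray T r R" for R
        using tree_ray_subset[OF that] True by (auto simp: char_fun_def PiE_iff)
      then show ?thesis by blast
    qed
    ultimately show ?thesis
      unfolding ray_space_def openin_subtopology by blast
  next
    case False
    then have "{R. tree_ray T r R \<and> A \<subseteq> R \<and> R \<inter> B = {}} = {}"
      using tree_ray_subset by blast
    then show ?thesis by (metis image_empty openin_empty)
  qed
qed

text \<open>A basic box around the point \<open>char_fun T R\<close> constrains a finite set of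
  coordinates. Those on \<open>R\<close> form \<open>A\<close>, those off \<open>R\<close> form
  \<open>B\<close>; a ray that contains \<open>A\<close> and avoids \<open>B\<close> agrees with
  \<open>R\<close> on all of them and so stays in the box.\<close>

lemma openin_ray_space_cylinder_subset:
  assumes "openin (ray_space T r) V" "tree_ray T r R" "char_fun T R \<in> V"
  obtains A B where "finite A" "finite B" "A \<subseteq> R" "R \<inter> B = {}"
    "\<And>Q. tree_ray T r Q \<Longrightarrow> A \<subseteq> Q \<Longrightarrow> Q \<inter> B = {} \<Longrightarrow> char_fun T Q \<in> V"
proof -
  obtain W where W: "openin (product_topology (\<lambda>_. discrete_topology UNIV) T) W"
    and V: "V = W \<inter> char_fun T ` {R. tree_ray T r R}"
    using assms(1) unfolding ray_space_def openin_subtopology by blast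
  then obtain U where fin: "finite {i \<in> T. U i \<noteq> UNIV}"
    and U: "char_fun T R \<in> PiE T U" "PiE T U \<subseteq> W"
    using W assms(3) unfolding V openin_product_topology_alt by auto
  let ?J = "{i \<in> T. U i \<noteq> UNIV}"
  show thesis
  proof
    show "finite (?J \<inter> R)" "finite (?J - R)" using fin by auto
    fix Q assume Q: "tree_ray T r Q" "?J \<inter> R \<subseteq> Q" "Q \<inter> (?J - R) = {}"
    have "char_fun T Q i \<in> U i" if "i \<in> T" for i
    proof (cases "i \<in> ?J")
      case True
      then have "char_fun T Q i = char_fun T R i"
        using Q that by (auto simp: char_fun_def)
      then show ?thesis using U(1) that by (auto simp: PiE_iff)
    qed (use that in auto)
    then have "char_fun T Q \<in> PiE T U" by (auto simp: char_fun_def PiE_iff)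
    then show "char_fun T Q \<in> V" using U(2) Q(1) V by blast
  qed auto
qed

text \<open>The strict predecessors of a node of a tree are always a down-closed chain, so being a
  ray says that they are nonempty and have no maximum. In particular the root is not a limit node.
  This form directly supplies the ray needed for completeness.\<close>

definition limit_node :: "'a set \<Rightarrow> 'a rel \<Rightarrow> 'a \<Rightarrow> bool" where
  "limit_node T r f \<longleftrightarrow> tree_ray T r (underS r f)"

text \<open>The base elements before passing to characteristic functions: order arguments are
  carried out on rays, and \<open>char_fun\<close> is applied only where the topology
  enters.\<close>

definition ray_cylinder :: "'a set \<Rightarrow> 'a rel \<Rightarrow> 'a \<Rightarrow> 'a set \<Rightarrow> 'a set set" where
  "ray_cylinder T r t F = {R. tree_ray T r R \<and> t \<in> R \<and> R \<inter> F = {}}"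

lemma tree_ray_down_closed: "tree_ray T r R \<Longrightarrow> x \<in> R \<Longrightarrow> (y, x) \<in> r \<Longrightarrow> y \<in> R"
  unfolding tree_ray_def tree_path_def under_def by blast

lemma tree_ray_total: "tree_ray T r R \<Longrightarrow> x \<in> R \<Longrightarrow> y \<in> R \<Longrightarrow> x \<noteq> y \<Longrightarrow> (x, y) \<in> r \<or> (y, x) \<in> r"
  unfolding tree_ray_def tree_path_def total_on_def by blast

section \<open>Order-theoretic facts about trees\<close>

context
  fixes T :: "'a set" and r :: "'a rel"
  assumes tree: "order_tree T r"
begin

lemma order_tree_field: "(x, y) \<in> r \<Longrightarrow> x \<in> T \<and> y \<in> T"
  using tree unfolding order_tree_def partial_order_on_def preorder_on_def by blast

lemma order_tree_refl: "x \<in> T \<Longrightarrow> (x, x) \<in> r"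
  using tree unfolding order_tree_def partial_order_on_def preorder_on_def refl_on_def by blast

lemma order_tree_trans: "(x, y) \<in> r \<Longrightarrow> (y, z) \<in> r \<Longrightarrow> (x, z) \<in> r"
  using tree unfolding order_tree_def partial_order_on_def preorder_on_def by (meson transD)

lemma order_tree_antisym: "(x, y) \<in> r \<Longrightarrow> (y, x) \<in> r \<Longrightarrow> x = y"
  using tree unfolding order_tree_def partial_order_on_def by (meson antisymD)

lemma order_tree_comparable:
  assumes "(x, z) \<in> r" "(y, z) \<in> r"
  shows "(x, y) \<in> r \<or> (y, x) \<in> r"
proof (cases "x = y \<or> x = z \<or> y = z")
  case True
  then show ?thesis using assms order_tree_refl order_tree_field by metis
next
  case False
  have "well_order_on (underS r z) (Restr r (underS r z))"
    using tree assms order_tree_field unfolding order_tree_def by blast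
  then have "total_on (underS r z) (Restr r (underS r z))"
    unfolding well_order_on_def linear_order_on_def by blast
  then show ?thesis
    using assms False unfolding total_on_def underS_def by blast
qed

text \<open>Well-foundedness is given only below single nodes. If \<open>A\<close> has members
  strictly below \<open>z\<close>, a minimal one among them is minimal in all of \<open>A\<close>,
  because everything below it is again strictly below \<open>z\<close>. Otherwise \<open>z\<close>
  itself is minimal.\<close>

lemma order_tree_minimal:
  assumes "A \<subseteq> T" "z \<in> A"
  obtains m where "m \<in> A" "\<And>y. y \<in> A \<Longrightarrow> (y, m) \<in> r \<Longrightarrow> y = m"
proof (cases "underS r z \<inter> A = {}")
  case True
  then show ?thesis using that[of z] assms(2) unfolding underS_def by blast
next
  case False
  let ?s = "Restr r (underS r z) - Id"
  have "well_order_on (underS r z) (Restr r (underS r z))"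
    using tree assms unfolding order_tree_def by blast
  then have "wf ?s" unfolding well_order_on_def by simp
  obtain a where "a \<in> underS r z \<inter> A" using False by blast
  with \<open>wf ?s\<close> obtain m where m: "m \<in> underS r z \<inter> A"
    and min: "\<And>y. (y, m) \<in> ?s \<Longrightarrow> y \<notin> underS r z \<inter> A"
    by (rule wfE_min) blast
  show ?thesis
  proof (rule that)
    show "m \<in> A" using m by blast
    fix y assume y: "y \<in> A" "(y, m) \<in> r"
    have "y \<in> underS r z"
      using m y order_tree_trans order_tree_antisym unfolding underS_def by blast
    then show "y = m" using min[of y] m y by blast
  qed
qed

section \<open>The cylinders with finitely many forbidden limit nodes form a base\<close>

lemma ray_avoids_node:
  assumes R: "tree_ray T r R" and "b \<notin> R"
  obtains s F where "s \<in> R" "finite F" "\<forall>f\<in>F. limit_node T r f" "R \<inter> F = {}"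
    "\<And>Q. Q \<in> ray_cylinder T r s F \<Longrightarrow> b \<notin> Q"
proof (cases "\<exists>s\<in>R. (s, b) \<notin> r")
  case True
  then obtain s where s: "s \<in> R" "(s, b) \<notin> r" by blast
  show ?thesis
  \<comment> \<open>As \<open>R\<close> is down-closed, \<open>b\<close> is not below
    \<open>s\<close> either. So \<open>s\<close> and \<open>b\<close> are incomparable and no ray
    contains both.\<close>
  proof (rule that[of s "{}"])
    fix Q assume "Q \<in> ray_cylinder T r s {}"
    then have Q: "tree_ray T r Q" "s \<in> Q" unfolding ray_cylinder_def by blast+
    have "(b, s) \<notin> r" using tree_ray_down_closed[OF R s(1)] \<open>b \<notin> R\<close> by blast
    then show "b \<notin> Q"
      using s \<open>b \<notin> R\<close> tree_ray_total[OF Q, of b] by blast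
  qed (use s in auto)
next
  case False
  \<comment> \<open>Now all of \<open>R\<close> lies below \<open>b\<close>. Any node
    \<open>s\<close> of \<open>R\<close> serves; \<open>b\<close> is excluded by forbidding a
    minimal node \<open>f\<close> below \<open>b\<close> outside \<open>R\<close>, since a ray
    through \<open>b\<close> contains \<open>f\<close>.\<close>
  obtain s where s: "s \<in> R" using R unfolding tree_ray_def tree_path_def by blast
  let ?A = "{x. (x, b) \<in> r \<and> x \<notin> R}"
  have "b \<in> ?A"
    using s False \<open>b \<notin> R\<close> order_tree_refl order_tree_field by blast
  have "?A \<subseteq> T" using order_tree_field by blast
  then obtain f where f: "f \<in> ?A" and min: "\<And>y. y \<in> ?A \<Longrightarrow> (y, f) \<in> r \<Longrightarrow> y = f"
    using \<open>b \<in> ?A\<close> by (rule order_tree_minimal) blast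
  \<comment> \<open>Strict predecessors of \<open>f\<close> are below \<open>b\<close>, hence in
    \<open>R\<close> by minimality of \<open>f\<close>. Conversely, a node of \<open>R\<close> is
    comparable with \<open>f\<close>, both being below \<open>b\<close>, and cannot be above
    \<open>f\<close> since \<open>R\<close> is down-closed.\<close>
  have "underS r f = R"
  proof
    show "underS r f \<subseteq> R"
      using f min order_tree_trans unfolding underS_def by blast
    show "R \<subseteq> underS r f"
    proof
      fix y assume y: "y \<in> R"
      then have "(y, f) \<in> r \<or> (f, y) \<in> r" using False f order_tree_comparable by blast
      moreover have "(f, y) \<notin> r" using f tree_ray_down_closed[OF R y] by blast
      ultimately show "y \<in> underS r f" using f y unfolding underS_def by blast
    qed
  qed
  show ?thesis
  proof (rule that[of s "{f}"])
    show "\<forall>f\<in>{f}. limit_node T r f"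
      using R \<open>underS r f = R\<close> unfolding limit_node_def by simp
    fix Q assume "Q \<in> ray_cylinder T r s {f}"
    then show "b \<notin> Q"
      using f tree_ray_down_closed[of T r Q b f] unfolding ray_cylinder_def by blast
  qed (use s f in auto)
qed

text \<open>A ray is a chain, so a single node of \<open>R\<close> above all of \<open>A\<close>
  takes care of \<open>A\<close>. The nodes of \<open>B\<close> are treated one at a time: passing
  to the larger of two nodes of \<open>R\<close> and to the union of the forbidden sets lies inside
  both cylinders.\<close>

lemma ray_cylinder_refines:
  assumes R: "tree_ray T r R" and "finite A" "A \<subseteq> R" and "finite B" "R \<inter> B = {}"
  obtains t F where "finite F" "\<forall>f\<in>F. limit_node T r f" "R \<in> ray_cylinder T r t F"
    "\<And>Q. Q \<in> ray_cylinder T r t F \<Longrightarrow> A \<subseteq> Q \<and> Q \<inter> B = {}"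
proof -
  have max: "\<exists>u\<in>R. (s, u) \<in> r \<and> (t, u) \<in> r" if "s \<in> R" "t \<in> R" for s t
    using that R tree_ray_total[OF R] order_tree_refl tree_ray_subset[OF R] by (metis subsetD)
  have mono: "ray_cylinder T r u (F \<union> G) \<subseteq> ray_cylinder T r s F" if "(s, u) \<in> r" for s u F G
    using tree_ray_down_closed[OF _ _ that] unfolding ray_cylinder_def by auto
  have "\<exists>t\<in>R. \<forall>a\<in>A. (a, t) \<in> r"
    using \<open>finite A\<close> \<open>A \<subseteq> R\<close>
  proof (induction A)
    case empty
    then show ?case using R unfolding tree_ray_def tree_path_def by blast
  next
    case (insert a A)
    then obtain t where "t \<in> R" "\<forall>a\<in>A. (a, t) \<in> r" by blast
    with insert.prems max[of a t] order_tree_trans show ?case by blast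
  qed
  then obtain t where t: "t \<in> R" "\<forall>a\<in>A. (a, t) \<in> r" by blast
  have "\<exists>t F. finite F \<and> (\<forall>f\<in>F. limit_node T r f) \<and> R \<in> ray_cylinder T r t F \<and>
    (\<forall>Q \<in> ray_cylinder T r t F. A \<subseteq> Q \<and> Q \<inter> B = {})"
    using \<open>finite B\<close> \<open>R \<inter> B = {}\<close>
  proof (induction B)
    case empty
    have "R \<in> ray_cylinder T r t {}"
      using t R unfolding ray_cylinder_def by blast
    moreover have "A \<subseteq> Q" if "Q \<in> ray_cylinder T r t {}" for Q
      using t(2) that tree_ray_down_closed[of T r Q t] unfolding ray_cylinder_def by blast
    ultimately show ?case by (intro exI[of _ t] exI[of _ "{}"]) auto
  next
    case (insert b B)
    then obtain t F where tF: "finite F" "\<forall>f\<in>F. limit_node T r f" "R \<in> ray_cylinder T r t F"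
      "\<forall>Q \<in> ray_cylinder T r t F. A \<subseteq> Q \<and> Q \<inter> B = {}" by auto
    obtain s G where sG: "s \<in> R" "finite G" "\<forall>f\<in>G. limit_node T r f" "R \<inter> G = {}"
      "\<And>Q. Q \<in> ray_cylinder T r s G \<Longrightarrow> b \<notin> Q"
      using ray_avoids_node[OF R, of b] insert.prems by auto
    obtain u where u: "u \<in> R" "(s, u) \<in> r" "(t, u) \<in> r"
      using max sG(1) tF(3) unfolding ray_cylinder_def by blast
    have sub: "ray_cylinder T r u (F \<union> G) \<subseteq> ray_cylinder T r t F"
      "ray_cylinder T r u (F \<union> G) \<subseteq> ray_cylinder T r s G"
      using mono[OF u(3), of F G] mono[OF u(2), of G F] by (simp_all add: Un_commute)
    have "R \<in> ray_cylinder T r u (F \<union> G)"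
      using R u(1) tF(3) sG(4) unfolding ray_cylinder_def by blast
    moreover have "\<forall>Q \<in> ray_cylinder T r u (F \<union> G). A \<subseteq> Q \<and> Q \<inter> insert b B = {}"
      using sub tF(4) sG(5) by blast
    moreover have "finite (F \<union> G)" "\<forall>f\<in>F \<union> G. limit_node T r f" using tF sG by auto
    ultimately show ?case by blast
  qed
  then obtain t F where "finite F" "\<forall>f\<in>F. limit_node T r f" "R \<in> ray_cylinder T r t F"
    "\<forall>Q \<in> ray_cylinder T r t F. A \<subseteq> Q \<and> Q \<inter> B = {}" by (elim exE conjE)
  then show thesis by (intro that[of F t]) simp_all
qed

section \<open>Completeness of the base\<close>

lemma ray_cylinders_pairwise_imp_common:
  assumes "I \<noteq> {}"
    and limit: "\<And>t F f. (t, F) \<in> I \<Longrightarrow> f \<in> F \<Longrightarrow> limit_node T r f"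
    and pairwise: "\<And>t F s G. (t, F) \<in> I \<Longrightarrow> (s, G) \<in> I \<Longrightarrow>
      ray_cylinder T r t F \<inter> ray_cylinder T r s G \<noteq> {}"
  obtains R where "\<And>t F. (t, F) \<in> I \<Longrightarrow> R \<in> ray_cylinder T r t F"
proof -
  define C where "C = fst ` I"
  define \<Phi> where "\<Phi> = \<Union>(snd ` I)"
  \<comment> \<open>A pair taken twice shows that its cylinder is nonempty, so its node lies on a
    ray.\<close>
  have CT: "C \<subseteq> T"
    using pairwise tree_ray_subset unfolding C_def ray_cylinder_def by fastforce
  have C_chain: "(s, t) \<in> r \<or> (t, s) \<in> r" if st: "s \<in> C" "t \<in> C" for s t
  proof (cases "s = t")
    case False
    obtain F G where "(s, F) \<in> I" "(t, G) \<in> I" using st unfolding C_def by auto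
    then obtain Q where "tree_ray T r Q" "s \<in> Q" "t \<in> Q"
      using pairwise unfolding ray_cylinder_def by blast
    then show ?thesis using False tree_ray_total[of T r Q s t] by blast
  qed (use CT st order_tree_refl in blast)
  \<comment> \<open>A ray common to the two cylinders contains \<open>t\<close> but avoids
    \<open>f\<close>, so by down-closure \<open>f\<close> is not below \<open>t\<close>. It remains
    to find a ray through all of \<open>C\<close> that avoids \<open>\<Phi>\<close>.\<close>
  have not_below: "(f, t) \<notin> r" if ft: "f \<in> \<Phi>" "t \<in> C" for f t
  proof
    assume "(f, t) \<in> r"
    obtain s F G where "(s, F) \<in> I" "f \<in> F" "(t, G) \<in> I"
      using ft unfolding C_def \<Phi>_def by auto
    then obtain Q where "tree_ray T r Q" "t \<in> Q" "f \<notin> Q"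
      using pairwise unfolding ray_cylinder_def by blast
    then show False using \<open>(f, t) \<in> r\<close> tree_ray_down_closed[of T r Q t f] by blast
  qed
  have "\<exists>R. tree_ray T r R \<and> C \<subseteq> R \<and> R \<inter> \<Phi> = {}"
  proof (cases "\<exists>t\<in>C. \<forall>s\<in>C. (s, t) \<in> r")
    case True
    then obtain t where t: "t \<in> C" and max: "\<And>s. s \<in> C \<Longrightarrow> (s, t) \<in> r" by blast
    have through: "C \<subseteq> R" if "tree_ray T r R" "t \<in> R" for R
      using max tree_ray_down_closed[OF that] by blast
    have above: "(t, f) \<in> r \<and> f \<noteq> t" if "tree_ray T r R" "t \<in> R" "f \<in> R \<inter> \<Phi>" for R f
    proof -
      have "(f, t) \<notin> r" using that(3) not_below[OF _ t] by blast
      moreover have "(t, t) \<in> r" using order_tree_refl CT t by blast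
      ultimately show ?thesis using that tree_ray_total[of T r R t f] by blast
    qed
    show ?thesis
    proof (cases "\<exists>f\<in>\<Phi>. (t, f) \<in> r")
      case True
      let ?A = "{f \<in> \<Phi>. (t, f) \<in> r}"
      obtain f0 where "f0 \<in> ?A" using True by blast
      have "?A \<subseteq> T" using order_tree_field by blast
      then obtain f where "f \<in> ?A" and "\<And>g. g \<in> ?A \<Longrightarrow> (g, f) \<in> r \<Longrightarrow> g = f"
        using \<open>f0 \<in> ?A\<close> by (rule order_tree_minimal) blast
      then have f: "f \<in> \<Phi>" "(t, f) \<in> r"
        and min: "\<And>g. g \<in> \<Phi> \<Longrightarrow> (t, g) \<in> r \<Longrightarrow> (g, f) \<in> r \<Longrightarrow> g = f" by auto
      have ray: "tree_ray T r (underS r f)"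
        using limit f(1) unfolding \<Phi>_def limit_node_def by auto
      have mem: "t \<in> underS r f"
        using f not_below[OF f(1) t] unfolding underS_def by blast
      \<comment> \<open>A forbidden node on this ray would lie above \<open>t\<close> and strictly
        below \<open>f\<close>, against the choice of \<open>f\<close>.\<close>
      have "g \<notin> \<Phi>" if "g \<in> underS r f" for g
        using above[OF ray mem, of g] min[of g] that unfolding underS_def by blast
      then have "underS r f \<inter> \<Phi> = {}" by blast
      then show ?thesis using ray mem through by blast
    next
      case False
      obtain F where "(t, F) \<in> I" using t unfolding C_def by auto
      then obtain R where "tree_ray T r R" "t \<in> R"
        using pairwise unfolding ray_cylinder_def by blast
      then show ?thesis using False above through by blast
    qed
  next
    case False
    \<comment> \<open>Without a maximum in \<open>C\<close>, its down-closure has no maximum either: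
      above \<open>x\<close> there is a \<open>t\<close> in \<open>C\<close>, and some
      \<open>s\<close> in \<open>C\<close> not below \<open>t\<close> is strictly above
      \<open>x\<close>. It avoids \<open>\<Phi>\<close> because no forbidden node lies below a
      member of \<open>C\<close>.\<close>
    define D where "D = {x. \<exists>t\<in>C. (x, t) \<in> r}"
    have "C \<subseteq> D" using CT order_tree_refl unfolding D_def by blast
    have "tree_path T r D"
      unfolding tree_path_def
    proof (intro conjI ballI)
      show "D \<noteq> {}" using \<open>C \<subseteq> D\<close> \<open>I \<noteq> {}\<close> unfolding C_def by blast
      show "D \<subseteq> T" using order_tree_field unfolding D_def by blast
      show "total_on D r"
        unfolding total_on_def
      proof (intro ballI impI)
        fix x y assume "x \<in> D" "y \<in> D"
        then obtain s t where "s \<in> C" "(x, s) \<in> r" "t \<in> C" "(y, t) \<in> r" unfolding D_def by blast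
        then show "(x, y) \<in> r \<or> (y, x) \<in> r"
          using C_chain[of s t] order_tree_trans order_tree_comparable by metis
      qed
      show "under r x \<subseteq> D" if "x \<in> D" for x
        using that order_tree_trans unfolding D_def under_def by blast
    qed
    moreover have "aboveS r x \<inter> D \<noteq> {}" if x: "x \<in> D" for x
    proof -
      obtain t where t: "t \<in> C" "(x, t) \<in> r" using x unfolding D_def by blast
      then obtain s where s: "s \<in> C" "(s, t) \<notin> r" using False by blast
      then have "(t, s) \<in> r" using C_chain t by blast
      then have "s \<in> aboveS r x"
        using s t order_tree_trans unfolding aboveS_def by blast
      then show ?thesis using s \<open>C \<subseteq> D\<close> by blast
    qed
    ultimately have "tree_ray T r D" unfolding tree_ray_def by blast
    moreover have "D \<inter> \<Phi> = {}" using not_below unfolding D_def by blast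
    ultimately show ?thesis using \<open>C \<subseteq> D\<close> by blast
  qed
  then obtain R where "tree_ray T r R" "C \<subseteq> R" "R \<inter> \<Phi> = {}" by blast
  then have "R \<in> ray_cylinder T r t F" if "(t, F) \<in> I" for t F
    using that unfolding C_def \<Phi>_def ray_cylinder_def by force
  then show thesis using that by blast
qed

lemma base_complete_ray_space: "base_complete (ray_space T r)"
proof -
  let ?c = "\<lambda>t F. char_fun T ` ray_cylinder T r t F"
  define \<B> where "\<B> = {?c t F |t F. finite F \<and> (\<forall>f\<in>F. limit_node T r f)}"
  have "open_base (ray_space T r) \<B>"
    unfolding open_base_def
  proof (rule openin_topology_base_unique[THEN iffD2], intro conjI allI impI)
    fix V assume "V \<in> \<B>"
    then obtain t F where "finite F" "V = ?c t F" unfolding \<B>_def by blast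
    then show "openin (ray_space T r) V"
      using openin_ray_space_cylinder[of "{t}" F] unfolding ray_cylinder_def by simp
  next
    fix U x assume U: "openin (ray_space T r) U \<and> x \<in> U"
    then have "x \<in> topspace (ray_space T r)" using openin_subset by blast
    then obtain R where R: "tree_ray T r R" and x: "x = char_fun T R"
      unfolding topspace_ray_space by blast
    obtain A B where AB: "finite A" "finite B" "A \<subseteq> R" "R \<inter> B = {}"
      "\<And>Q. tree_ray T r Q \<Longrightarrow> A \<subseteq> Q \<Longrightarrow> Q \<inter> B = {} \<Longrightarrow> char_fun T Q \<in> U"
      using openin_ray_space_cylinder_subset[of T r U R] U R unfolding x by blast
    obtain t F where tF: "finite F" "\<forall>f\<in>F. limit_node T r f" "R \<in> ray_cylinder T r t F"
      "\<And>Q. Q \<in> ray_cylinder T r t F \<Longrightarrow> A \<subseteq> Q \<and> Q \<inter> B = {}"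
      using ray_cylinder_refines[OF R AB(1,3,2,4)] by metis
    have "char_fun T Q \<in> U" if "Q \<in> ray_cylinder T r t F" for Q
      using tF(4)[OF that] AB(5)[of Q] that unfolding ray_cylinder_def by blast
    then have "?c t F \<subseteq> U" by blast
    moreover have "?c t F \<in> \<B>" using tF(1,2) unfolding \<B>_def by blast
    moreover have "x \<in> ?c t F" using tF(3) x by blast
    ultimately show "\<exists>V. V \<in> \<B> \<and> x \<in> V \<and> V \<subseteq> U" by blast
  qed
  moreover have "complete_family \<B>"
    unfolding complete_family_def
  proof (intro allI impI)
    fix \<C> assume C: "\<C> \<subseteq> \<B> \<and> \<C> \<noteq> {} \<and> centered \<C>"
    \<comment> \<open>A base element may come from several pairs. Collecting all pairs that
      represent members of \<open>\<C>\<close> avoids choosing among them.\<close>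
    define I where "I = {(t, F). (\<forall>f\<in>F. limit_node T r f) \<and> ?c t F \<in> \<C>}"
    have cover: "\<exists>t F. (t, F) \<in> I \<and> V = ?c t F" if "V \<in> \<C>" for V
      using that C unfolding I_def \<B>_def by blast
    have "ray_cylinder T r t F \<inter> ray_cylinder T r s G \<noteq> {}"
      if "(t, F) \<in> I" "(s, G) \<in> I" for t F s G
    proof -
      let ?\<F> = "{?c t F, ?c s G}"
      have "?\<F> \<subseteq> \<C> \<and> finite ?\<F> \<and> ?\<F> \<noteq> {}" using that unfolding I_def by simp
      then have "\<Inter>?\<F> \<noteq> {}" using C unfolding centered_def by meson
      then obtain P Q where PQ: "P \<in> ray_cylinder T r t F" "Q \<in> ray_cylinder T r s G"
        and eq: "char_fun T P = char_fun T Q" by auto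
      \<comment> \<open>Images of cylinders meet only where the cylinders do, as
        \<open>char_fun T\<close> is injective on subsets of \<open>T\<close>.\<close>
      have "P = Q"
        using PQ tree_ray_subset[of T r P] tree_ray_subset[of T r Q] char_fun_inj[OF eq]
        unfolding ray_cylinder_def by simp
      then show ?thesis using PQ by blast
    qed
    moreover have "I \<noteq> {}" using C cover by blast
    ultimately obtain R where "\<And>t F. (t, F) \<in> I \<Longrightarrow> R \<in> ray_cylinder T r t F"
      using ray_cylinders_pairwise_imp_common[of I] unfolding I_def by blast
    then have "char_fun T R \<in> \<Inter>\<C>" using cover by blast
    then show "\<Inter>\<C> \<noteq> {}" by blast
  qed
  ultimately show ?thesis unfolding base_complete_def by blast
qed

end

theorem proposition2p12:
  fixes T :: "'a set" and r :: "'a rel"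
  assumes "order_tree T r"
  shows "base_complete (ray_space T r) \<and> Baire_space (ray_space T r)"
  using base_complete_ray_space[OF assms] by (simp add: base_complete_imp_Baire_space)

end
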